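(* Let $n\ge 1$ and $t\ge 1$, and let $S$ be a $t$-perfect distance-dominating set ($t$-PDDS) in $\Lambda_n$. Then each connected component of the induced subgraph $[S]$ is (isomorphic to) a Cartesian product of paths, where the paths may be finite or infinite.
   Context: $\Lambda_n$ is the infinite graph with vertex set $\mathbb{Z}^n$ in which two vertices are adjacent iff their Euclidean distance is $1$; $d$ denotes graph distance. For a graph $\Gamma=(V,E)$ and $S\subset V$, $[S]$ is the subgraph induced by $S$, and for a set $C$ of vertices $d(v,C)=\min\{d(v,w): w\in C\}$. For $t\ge 1$, a set $S\subset V$ is a $t$-PDDS in $\Gamma$ if for each $v\in V$ there is a unique component $C_v$ of $[S]$ with $d(v,C_v)\le t$, and there is in $C_v$ a unique vertex $w$ with $d(v,w)=d(v,C_v)$. *)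

theory Defs
  imports
    "HOL-Analysis.Finite_Cartesian_Product"
    "HOL-Library.Extended_Nat"
    "HOL-Library.FuncSet"
begin

record 'a sgraph =
  vset :: "'a set"
  adj :: "'a \<Rightarrow> 'a \<Rightarrow> bool"

definition induced :: "'a sgraph \<Rightarrow> 'a set \<Rightarrow> 'a sgraph" where
  "induced G S =
     \<lparr>vset = vset G \<inter> S, adj = (\<lambda>u v. u \<in> S \<and> v \<in> S \<and> adj G u v)\<rparr>"

definition walk_betw :: "'a sgraph \<Rightarrow> 'a \<Rightarrow> 'a list \<Rightarrow> 'a \<Rightarrow> bool" where
  "walk_betw G u xs v \<longleftrightarrow>
     xs \<noteq> [] \<and> set xs \<subseteq> vset G \<and> successively (adj G) xs \<and> hd xs = u \<and> last xs = v"

text \<open>The value is \<open>\<infinity>\<close> if no walk joins the two vertices.\<close>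
definition gdist :: "'a sgraph \<Rightarrow> 'a \<Rightarrow> 'a \<Rightarrow> enat" where
  "gdist G u v = (INF xs \<in> {xs. walk_betw G u xs v}. enat (length xs - 1))"

text \<open>As \<^typ>\<open>enat\<close> is well-ordered, the infimum is a minimum whenever \<open>C\<close> is nonempty.\<close>
definition set_gdist :: "'a sgraph \<Rightarrow> 'a \<Rightarrow> 'a set \<Rightarrow> enat" where
  "set_gdist G v C = (INF w \<in> C. gdist G v w)"

text \<open>A component is represented by its vertex set; as a graph it is the subgraph induced by that
  set.\<close>
definition graph_components :: "'a sgraph \<Rightarrow> 'a set set" where
  "graph_components G = (\<lambda>u. {v. \<exists>xs. walk_betw G u xs v}) ` vset G"

definition graph_iso :: "'a sgraph \<Rightarrow> 'b sgraph \<Rightarrow> bool" where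
  "graph_iso G H \<longleftrightarrow>
     (\<exists>f. bij_betw f (vset G) (vset H) \<and>
          (\<forall>u \<in> vset G. \<forall>v \<in> vset G. adj G u v \<longleftrightarrow> adj H (f u) (f v)))"

text \<open>Distances are taken in the ambient graph \<open>G\<close>, not in the subgraph induced by \<open>S\<close>.\<close>
definition is_PDDS :: "'a sgraph \<Rightarrow> nat \<Rightarrow> 'a set \<Rightarrow> bool" where
  "is_PDDS G t S \<longleftrightarrow>
     S \<subseteq> vset G \<and>
     (\<forall>v \<in> vset G.
        (\<exists>!C. C \<in> graph_components (induced G S) \<and> set_gdist G v C \<le> enat t) \<and>
        (\<forall>C. C \<in> graph_components (induced G S) \<and> set_gdist G v C \<le> enat t \<longrightarrow>
             (\<exists>!w. w \<in> C \<and> gdist G v w = set_gdist G v C)))"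

definition grid :: "(int ^ 'n) sgraph" where
  "grid =
     \<lparr>vset = UNIV,
      adj = (\<lambda>u v. dist (\<chi> i. real_of_int (u $ i)) (\<chi> i. real_of_int (v $ i) :: real ^ 'n) = 1)\<rparr>"

definition int_path :: "int set \<Rightarrow> int sgraph" where
  "int_path A = \<lparr>vset = A, adj = (\<lambda>x y. x \<in> A \<and> y \<in> A \<and> \<bar>x - y\<bar> = 1)\<rparr>"

text \<open>Up to isomorphism: the finite paths on \<open>m \<ge> 1\<close> vertices, the one-way infinite path and the
  two-way infinite path.\<close>
definition path_graphs :: "int sgraph set" where
  "path_graphs =
     {int_path {0..<int m} | m. m \<ge> 1} \<union> {int_path {0..}, int_path UNIV}"

definition cartesian_product :: "'i set \<Rightarrow> ('i \<Rightarrow> 'a sgraph) \<Rightarrow> ('i \<Rightarrow> 'a) sgraph" where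
  "cartesian_product I P =
     \<lparr>vset = (\<Pi>\<^sub>E i\<in>I. vset (P i)),
      adj = (\<lambda>f g. \<exists>i\<in>I. adj (P i) (f i) (g i) \<and> (\<forall>j\<in>I - {i}. f j = g j))\<rparr>"

end

theory Submission
  imports Defs
begin

text \<open>
  Since \<open>t \<ge> 1\<close>, a vertex outside a component \<open>C\<close> of \<open>[S]\<close> has at most one neighbour in \<open>C\<close>, so
  \<open>C\<close> contains every common neighbour of two distinct members. For a connected subset of the grid
  this local convexity implies geodesic convexity, by induction along a walk: when the walk leaves
  the box spanned so far, the new face is filled in starting from the endpoint of the walk. A
  convex subset of the grid is the product of its coordinate projections, which are intervals.
\<close>

section \<open>Walks and components\<close>

lemma gdist_le_1: "adj G u v \<Longrightarrow> u \<in> vset G \<Longrightarrow> v \<in> vset G \<Longrightarrow> gdist G u v \<le> 1"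
  unfolding gdist_def
  by (rule INF_lower2[of "[u, v]"]) (auto simp: walk_betw_def one_enat_def)

lemma gdist_ge_1:
  assumes "u \<noteq> v"
  shows "1 \<le> gdist G u v"
  unfolding gdist_def
proof (rule INF_greatest)
  fix xs assume "xs \<in> {xs. walk_betw G u xs v}"
  then have "length xs \<ge> 2"
    using assms by (cases xs; cases "tl xs") (auto simp: walk_betw_def)
  then show "1 \<le> enat (length xs - 1)"
    by (simp add: one_enat_def)
qed

text \<open>Passing to a reflexive transitive closure makes symmetry, transitivity and induction
  along a walk available. The relation records that both ends of each step are vertices, so the
  converse direction has to ask this only of the starting vertex, where the closure is reflexive
  unconditionally.\<close>

lemma walk_betw_imp_rtranclp:
  assumes "walk_betw G u xs v"
  shows "(\<lambda>x y. x \<in> vset G \<and> y \<in> vset G \<and> adj G x y)\<^sup>*\<^sup>* u v"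
  using assms
proof (induction xs arbitrary: u)
  case Nil
  then show ?case by (simp add: walk_betw_def)
next
  case (Cons a xs)
  show ?case
  proof (cases xs)
    case Nil
    then show ?thesis using Cons.prems by (auto simp: walk_betw_def)
  next
    case (Cons b ys)
    then have "walk_betw G b xs v" "u \<in> vset G" "b \<in> vset G" "adj G u b"
      using Cons.prems by (auto simp: walk_betw_def)
    then show ?thesis
      using Cons.IH[of b] by (intro converse_rtranclp_into_rtranclp[of _ u b v]) auto
  qed
qed

lemma rtranclp_imp_walk_betw:
  assumes "(\<lambda>x y. x \<in> vset G \<and> y \<in> vset G \<and> adj G x y)\<^sup>*\<^sup>* u v" and "u \<in> vset G"
  shows "\<exists>xs. walk_betw G u xs v"
  using assms(1)
proof (induction rule: rtranclp_induct)
  case base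
  show ?case
    using assms(2) by (intro exI[of _ "[u]"]) (simp add: walk_betw_def)
next
  case (step y z)
  then obtain xs where "walk_betw G u xs y" by blast
  with step.hyps(2) have "walk_betw G u (xs @ [z]) z"
    by (auto simp: walk_betw_def successively_append_iff)
  then show ?case by blast
qed

lemma graph_component_subset: "C \<in> graph_components G \<Longrightarrow> C \<subseteq> vset G"
  by (force simp: graph_components_def walk_betw_def)

text \<open>The root \<open>r\<close> of the component reaches \<open>u\<close> and
  \<open>v\<close>, and symmetry reverses the way to \<open>u\<close>. Every vertex on the resulting
  way from \<open>u\<close> to \<open>v\<close> is again reachable from \<open>r\<close>, so the way
  never leaves \<open>C\<close>. This confinement is what the later induction along walks relies
  on.\<close>

lemma graph_component_connected:
  assumes C: "C \<in> graph_components G" and sym: "symp (adj G)" and uv: "u \<in> C" "v \<in> C"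
  shows "(\<lambda>x y. x \<in> C \<and> y \<in> C \<and> adj G x y)\<^sup>*\<^sup>* u v"
proof -
  define R where "R = (\<lambda>x y. x \<in> vset G \<and> y \<in> vset G \<and> adj G x y)"
  obtain r where r: "r \<in> vset G" "C = {v. \<exists>xs. walk_betw G r xs v}"
    using C by (auto simp: graph_components_def)
  have C_iff: "w \<in> C \<longleftrightarrow> R\<^sup>*\<^sup>* r w" for w
    using r walk_betw_imp_rtranclp[of G r _ w] rtranclp_imp_walk_betw[of G r w]
    by (auto simp: R_def)
  have "symp R"
    using sym by (auto simp: R_def symp_def)
  then have "symp R\<^sup>*\<^sup>*"
    by (rule symp_rtranclp)
  then have "R\<^sup>*\<^sup>* u v"
    using uv C_iff by (meson rtranclp_trans sympD)
  then show ?thesis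
  proof (induction rule: rtranclp_induct)
    case (step y z)
    have "R\<^sup>*\<^sup>* r y"
      using C_iff uv(1) step.hyps(1) by (meson rtranclp_trans)
    with step.hyps(2) have "y \<in> C" "z \<in> C" "adj G y z"
      using C_iff by (auto simp: R_def intro: rtranclp.rtrancl_into_rtrancl)
    with step.IH show ?case
      by (auto intro: rtranclp.rtrancl_into_rtrancl)
  qed auto
qed

section \<open>Local convexity of the components\<close>

text \<open>Otherwise \<open>a\<close> and \<open>b\<close> both realise the distance 1 from
  \<open>v\<close> to \<open>C\<close>. As 1 is at most \<open>t\<close>, this contradicts the
  uniqueness of the nearest vertex in \<open>C\<close>.\<close>

lemma PDDS_component_common_neighbour:
  assumes S: "is_PDDS G t S" and t: "t \<ge> 1" and C: "C \<in> graph_components (induced G S)"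
    and ab: "a \<in> C" "b \<in> C" "a \<noteq> b"
    and v: "v \<in> vset G" "adj G v a" "adj G v b"
  shows "v \<in> C"
proof (rule ccontr)
  assume "v \<notin> C"
  then have ge: "1 \<le> gdist G v w" if "w \<in> C" for w
    using that by (intro gdist_ge_1) auto
  have "C \<subseteq> vset G"
    using graph_component_subset[OF C] by (auto simp: induced_def)
  then have one: "gdist G v a = 1" "gdist G v b = 1"
    using ge ab v by (auto intro!: antisym gdist_le_1)
  have set_one: "set_gdist G v C = 1"
    unfolding set_gdist_def
  proof (rule antisym)
    show "(INF w\<in>C. gdist G v w) \<le> 1"
      using ab(1) one(1) by (metis INF_lower)
    show "1 \<le> (INF w\<in>C. gdist G v w)"
      by (rule INF_greatest) (rule ge)
  qed
  then have "set_gdist G v C \<le> enat t"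
    using t by (simp add: one_enat_def)
  then have "\<exists>!w. w \<in> C \<and> gdist G v w = set_gdist G v C"
    using S C v(1) by (auto simp: is_PDDS_def)
  then show False
    using ab one set_one by auto
qed

section \<open>Convex subsets of the grid\<close>

lemma adj_grid_iff:
  fixes u v :: "int ^ 'n"
  shows "adj grid u v \<longleftrightarrow> (\<exists>i. \<bar>u $ i - v $ i\<bar> = 1 \<and> (\<forall>j. j \<noteq> i \<longrightarrow> u $ j = v $ j))"
proof -
  \<comment> \<open>The squares are taken in the naturals, where a sum equals 1 only if one term is
    1 and all others vanish.\<close>
  define f where "f i = (nat \<bar>u $ i - v $ i\<bar>)\<^sup>2" for i
  have f: "(dist (real_of_int (u $ i)) (real_of_int (v $ i)))\<^sup>2 = real (f i)" for i
    by (simp add: f_def dist_real_def)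
  have "adj grid u v \<longleftrightarrow> sqrt (real (\<Sum>i\<in>UNIV. f i)) = 1"
    by (simp add: grid_def dist_vec_def L2_set_def f)
  also have "\<dots> \<longleftrightarrow> (\<Sum>i\<in>UNIV. f i) = 1"
    by (simp del: of_nat_sum)
  also have "\<dots> \<longleftrightarrow> (\<exists>i. f i = 1 \<and> (\<forall>j. i \<noteq> j \<longrightarrow> f j = 0))"
    by (subst sum_eq_1_iff) auto
  also have "\<dots> \<longleftrightarrow> (\<exists>i. \<bar>u $ i - v $ i\<bar> = 1 \<and> (\<forall>j. j \<noteq> i \<longrightarrow> u $ j = v $ j))"
  proof -
    have "f i = 1 \<longleftrightarrow> \<bar>u $ i - v $ i\<bar> = 1" "f i = 0 \<longleftrightarrow> u $ i = v $ i" for i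
      by (auto simp: f_def power_eq_1_iff nat_eq_iff)
    then show ?thesis by auto
  qed
  finally show ?thesis .
qed

lemma symp_adj_grid: "symp (adj (grid :: (int ^ 'n) sgraph))"
  by (rule sympI) (simp add: adj_grid_iff, metis abs_minus_commute)

lemma vset_grid [simp]: "vset grid = UNIV"
  by (simp add: grid_def)

text \<open>The geodesic interval of the grid: the vertices on shortest paths from \<open>u\<close>
  to \<open>w\<close>.\<close>

definition grid_box :: "int ^ 'n \<Rightarrow> int ^ 'n \<Rightarrow> (int ^ 'n) set" where
  "grid_box u w = {x. \<forall>i. min (u $ i) (w $ i) \<le> x $ i \<and> x $ i \<le> max (u $ i) (w $ i)}"

text \<open>Convexity tested only on geodesics of length two: the grid is bipartite, so distinct
  vertices with a common neighbour are at distance two.\<close>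

definition locally_convex :: "(int ^ 'n) set \<Rightarrow> bool" where
  "locally_convex C \<longleftrightarrow>
     (\<forall>a\<in>C. \<forall>b\<in>C. \<forall>v. a \<noteq> b \<longrightarrow> adj grid v a \<longrightarrow> adj grid v b \<longrightarrow> v \<in> C)"

lemma locally_convexD:
  "locally_convex C \<Longrightarrow> a \<in> C \<Longrightarrow> b \<in> C \<Longrightarrow> a \<noteq> b \<Longrightarrow> adj grid v a \<Longrightarrow> adj grid v b \<Longrightarrow> v \<in> C"
  unfolding locally_convex_def by blast

text \<open>If \<open>w'\<close> is a step towards \<open>u\<close>, the box shrinks. Otherwise the
  new vertices form a face orthogonal to the direction \<open>i\<close> of the step. A vertex of
  this face other than \<open>w'\<close> has one neighbour in the face that is nearer to
  \<open>w'\<close> and one in the old box, so local convexity captures it.\<close>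

lemma grid_box_extend:
  fixes C :: "(int ^ 'n) set"
  assumes C: "locally_convex C" and box: "grid_box u w \<subseteq> C" and w': "w' \<in> C"
    and adj: "adj grid w w'"
  shows "grid_box u w' \<subseteq> C"
proof -
  obtain i where i: "\<bar>w $ i - w' $ i\<bar> = 1" "\<And>j. j \<noteq> i \<Longrightarrow> w $ j = w' $ j"
    using adj by (auto simp: adj_grid_iff)
  \<comment> \<open>The measure is the grid distance from \<open>x\<close> to
    \<open>w'\<close>.\<close>
  have face: "x \<in> C" if "x \<in> grid_box u w'" "x \<notin> grid_box u w" for x
    using that
  proof (induction "\<Sum>j\<in>UNIV. nat \<bar>x $ j - w' $ j\<bar>" arbitrary: x rule: less_induct)
    case less
    have x_box: "min (u $ j) (w' $ j) \<le> x $ j" "x $ j \<le> max (u $ j) (w' $ j)" for j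
      using less.prems(1) by (auto simp: grid_box_def)
    have out_i: "\<not> (min (u $ i) (w $ i) \<le> x $ i \<and> x $ i \<le> max (u $ i) (w $ i))"
    proof -
      obtain l where l: "\<not> (min (u $ l) (w $ l) \<le> x $ l \<and> x $ l \<le> max (u $ l) (w $ l))"
        using less.prems(2) by (auto simp: grid_box_def)
      then have "l = i"
        using x_box[of l] i(2)[of l] by metis
      with l show ?thesis by simp
    qed
    \<comment> \<open>Since \<open>w\<close> and \<open>w'\<close> differ by one in coordinate
      \<open>i\<close>, the new box admits at most one value there that the old box lacks, namely
      that of \<open>w'\<close>.\<close>
    have xi: "x $ i = w' $ i"
      using out_i x_box[of i] i(1) by (auto simp: min_def max_def abs_if split: if_splits)
    show ?case
    proof (cases "x = w'")
      case True
      then show ?thesis using w' by simp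
    next
      case False
      then obtain j where j: "x $ j \<noteq> w' $ j"
        by (auto simp: vec_eq_iff)
      with xi have ji: "j \<noteq> i" by auto
      \<comment> \<open>\<open>y\<close> moves \<open>x\<close> one step towards \<open>w'\<close>
        within the face; \<open>z\<close> moves \<open>x\<close> back across the face into the old
        box.\<close>
      define y where "y = (\<chi> l. if l = j then x $ l + sgn (w' $ j - x $ j) else x $ l)"
      define z where "z = (\<chi> l. if l = i then w $ i else x $ l)"
      have y_nth: "y $ l = (if l = j then x $ l + sgn (w' $ j - x $ j) else x $ l)"
        and z_nth: "z $ l = (if l = i then w $ i else x $ l)" for l
        by (auto simp: y_def z_def)
      have "(\<Sum>l\<in>UNIV. nat \<bar>y $ l - w' $ l\<bar>) < (\<Sum>l\<in>UNIV. nat \<bar>x $ l - w' $ l\<bar>)"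
      proof (rule sum_strict_mono_ex1)
        show "\<forall>l\<in>UNIV. nat \<bar>y $ l - w' $ l\<bar> \<le> nat \<bar>x $ l - w' $ l\<bar>"
          using j by (auto simp: y_nth sgn_if)
        show "\<exists>l\<in>UNIV. nat \<bar>y $ l - w' $ l\<bar> < nat \<bar>x $ l - w' $ l\<bar>"
          using j by (intro bexI[of _ j]) (auto simp: y_nth sgn_if)
      qed simp
      moreover have "min (u $ l) (w' $ l) \<le> y $ l \<and> y $ l \<le> max (u $ l) (w' $ l)" for l
        using x_box[of l] j by (auto simp: y_nth sgn_if min_def max_def split: if_splits)
      then have "y \<in> grid_box u w'"
        by (simp add: grid_box_def)
      moreover have "y \<notin> grid_box u w"
        using out_i ji by (auto simp: grid_box_def y_nth dest: spec[of _ i])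
      ultimately have "y \<in> C"
        by (rule less.hyps)
      moreover have "min (u $ l) (w $ l) \<le> z $ l \<and> z $ l \<le> max (u $ l) (w $ l)" for l
        using x_box[of l] i(2)[of l] by (auto simp: z_nth)
      then have "z \<in> C"
        using box by (auto simp: grid_box_def)
      moreover have "y \<noteq> z"
        using xi i(1) ji by (auto simp: vec_eq_iff y_nth z_nth intro!: exI[of _ i])
      moreover have "adj grid x y"
        unfolding adj_grid_iff using j by (intro exI[of _ j]) (auto simp: y_nth sgn_if)
      moreover have "adj grid x z"
        unfolding adj_grid_iff using xi i(1) by (intro exI[of _ i]) (auto simp: z_nth)
      ultimately show ?thesis
        using locally_convexD[OF C] by blast
    qed
  qed
  then show ?thesis using box by blast
qed

text \<open>The box from the fixed \<open>u\<close> follows the current end of the walk, starting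
  from the single vertex \<open>u\<close>. Connectedness matters: two vertices far apart form a
  locally convex set that does not contain their box.\<close>

lemma locally_convex_imp_convex:
  fixes C :: "(int ^ 'n) set"
  assumes C: "locally_convex C"
    and conn: "(\<lambda>x y. x \<in> C \<and> y \<in> C \<and> adj grid x y)\<^sup>*\<^sup>* u w" and u: "u \<in> C"
  shows "grid_box u w \<subseteq> C"
  using conn
proof (induction rule: rtranclp_induct)
  case base
  have "grid_box u u = {u}"
    by (auto simp: grid_box_def vec_eq_iff order_antisym)
  then show ?case using u by simp
next
  case (step y z)
  then show ?case using grid_box_extend[OF C] by blast
qed

text \<open>Each coordinate of \<open>x\<close> is attained in \<open>C\<close>, though possibly by
  different members. Finitely many corrections, one coordinate at a time, merge these into one
  member equal to \<open>x\<close>.\<close>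

lemma convex_imp_product:
  fixes C :: "(int ^ 'n) set"
  assumes conv: "\<And>u w. u \<in> C \<Longrightarrow> w \<in> C \<Longrightarrow> grid_box u w \<subseteq> C" and ne: "C \<noteq> {}"
  shows "C = {x. \<forall>i. x $ i \<in> (\<lambda>u. u $ i) ` C}"
proof (intro equalityI subsetI)
  fix x assume "x \<in> {x. \<forall>i. x $ i \<in> (\<lambda>u. u $ i) ` C}"
  then have x: "\<exists>w\<in>C. w $ i = x $ i" for i
    by (auto simp: image_iff) (metis)
  have "\<exists>u\<in>C. \<forall>i\<in>I. u $ i = x $ i" for I :: "'n set"
    using finite[of I]
  proof (induction I rule: finite_induct)
    case empty
    then show ?case using ne by auto
  next
    case (insert i I)
    then obtain u w where u: "u \<in> C" "\<forall>i\<in>I. u $ i = x $ i" and w: "w \<in> C" "w $ i = x $ i"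
      using x by blast
    \<comment> \<open>A corner of the box of \<open>u\<close> and \<open>w\<close>: coordinate
      \<open>i\<close> comes from \<open>w\<close>, the others from \<open>u\<close>, so agreement
      with \<open>x\<close> on \<open>I\<close> survives.\<close>
    let ?v = "\<chi> j. if j = i then x $ i else u $ j"
    have "?v \<in> grid_box u w"
      using w by (auto simp: grid_box_def)
    then have "?v \<in> C"
      using conv u(1) w(1) by blast
    then show ?case
      using u(2) by (intro bexI[of _ ?v]) auto
  qed
  from this[of UNIV] obtain u where "u \<in> C" "\<forall>i. u $ i = x $ i"
    by auto
  then show "x \<in> C"
    by (metis vec_eq_iff)
qed auto

section \<open>Products of integer intervals\<close>

lemma graph_isoI:
  assumes "bij_betw f (vset G) (vset H)"
    and "\<And>u v. u \<in> vset G \<Longrightarrow> v \<in> vset G \<Longrightarrow> adj G u v \<longleftrightarrow> adj H (f u) (f v)"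
  shows "graph_iso G H"
  using assms unfolding graph_iso_def by blast

lemma vset_int_path [simp]: "vset (int_path A) = A"
  and adj_int_path [simp]: "adj (int_path A) x y \<longleftrightarrow> x \<in> A \<and> y \<in> A \<and> \<bar>x - y\<bar> = 1"
  by (simp_all add: int_path_def)

text \<open>A translation or a reflection does it. Stating that \<open>f\<close> preserves absolute
  differences of all integers yields injectivity and preservation of adjacency at once.\<close>

lemma int_interval_iso_path:
  fixes A :: "int set"
  assumes ne: "A \<noteq> {}" and conv: "\<And>a b c. a \<in> A \<Longrightarrow> b \<in> A \<Longrightarrow> a \<le> c \<Longrightarrow> c \<le> b \<Longrightarrow> c \<in> A"
  shows "\<exists>B f. int_path B \<in> path_graphs \<and> bij_betw f A B \<and> (\<forall>x y. \<bar>f x - f y\<bar> = \<bar>x - y\<bar>)"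
proof -
  have least: "\<exists>m\<in>X. \<forall>x\<in>X. m \<le> x" if ne: "X \<noteq> {}" and b: "\<forall>x\<in>X. b \<le> x" for X :: "int set" and b
  proof -
    obtain x0 where x0: "x0 \<in> X" using ne by auto
    \<comment> \<open>The offset from the lower bound \<open>b\<close> turns the search for a
      minimum into one over the naturals.\<close>
    define m where "m = (LEAST k. b + int k \<in> X)"
    have ex: "b + int (nat (x - b)) \<in> X" if "x \<in> X" for x
      using that b by auto
    have "b + int m \<in> X"
      unfolding m_def by (rule LeastI) (rule ex[OF x0])
    moreover have "b + int m \<le> x" if "x \<in> X" for x
    proof -
      have "m \<le> nat (x - b)"
        unfolding m_def by (rule Least_le) (rule ex[OF that])
      then show ?thesis using that b by auto
    qed
    ultimately show ?thesis by blast
  qed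
  have greatest: "\<exists>m\<in>A. \<forall>x\<in>A. x \<le> m" if "\<forall>x\<in>A. x \<le> b" for b
    using least[of "uminus ` A" "- b"] that ne by auto
  consider (below) m where "m \<in> A" "\<forall>x\<in>A. m \<le> x"
    | (above) M where "\<nexists>b. \<forall>x\<in>A. b \<le> x" "M \<in> A" "\<forall>x\<in>A. x \<le> M"
    | (unbounded) "\<nexists>b. \<forall>x\<in>A. b \<le> x" "\<nexists>b. \<forall>x\<in>A. x \<le> b"
    using least[OF ne] greatest by blast
  then show ?thesis
  proof cases
    case below
    show ?thesis
    proof (cases "\<exists>b. \<forall>x\<in>A. x \<le> b")
      case True
      then obtain M where M: "M \<in> A" "\<forall>x\<in>A. x \<le> M"
        using greatest by blast
      with below have "A = {m..M}" "m \<le> M"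
        by (auto intro: conv[OF below(1) M(1)])
      \<comment> \<open>The interval has \<open>M - m + 1\<close> elements, at least one because
        \<open>m\<close> is at most \<open>M\<close>.\<close>
      then have "bij_betw (\<lambda>x. x - m) A {0..<int (nat (M - m + 1))}"
        by (intro bij_betw_byWitness[where f' = "\<lambda>x. x + m"]) auto
      moreover have "int_path {0..<int (nat (M - m + 1))} \<in> path_graphs"
        using \<open>m \<le> M\<close> unfolding path_graphs_def
        by (intro UnI1 CollectI exI[of _ "nat (M - m + 1)"]) auto
      ultimately show ?thesis
        by (intro exI conjI) auto
    next
      case False
      have "x \<in> A" if x: "m \<le> x" for x
      proof -
        obtain b where "b \<in> A" "x \<le> b"
          using False by (meson linear)
        then show ?thesis
          using conv[OF below(1) _ x] by blast
      qed
      then have "A = {m..}"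
        using below(2) by auto
      then have "bij_betw (\<lambda>x. x - m) A {0..}"
        by (intro bij_betw_byWitness[where f' = "\<lambda>x. x + m"]) auto
      moreover have "int_path {0..} \<in> path_graphs"
        unfolding path_graphs_def by auto
      ultimately show ?thesis
        by (intro exI conjI) auto
    qed
  next
    case above
    have "x \<in> A" if x: "x \<le> M" for x
    proof -
      obtain b where "b \<in> A" "b \<le> x"
        using above(1) by (meson linear)
      then show ?thesis
        using conv[OF _ above(2) _ x] by blast
    qed
    then have "A = {..M}"
      using above(3) by auto
    \<comment> \<open>The only one-way infinite path in \<open>path_graphs\<close> points upwards,
      so a ray pointing downwards is reflected.\<close>
    then have "bij_betw (\<lambda>x. M - x) A {0..}"
      by (intro bij_betw_byWitness[where f' = "\<lambda>x. M - x"]) auto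
    moreover have "int_path {0..} \<in> path_graphs"
      unfolding path_graphs_def by auto
    ultimately show ?thesis
      by (intro exI conjI) auto
  next
    case unbounded
    have "c \<in> A" for c
      using unbounded conv by (meson linear)
    then have "bij_betw (\<lambda>x. x) A UNIV"
      by (auto simp: bij_betw_def)
    moreover have "int_path UNIV \<in> path_graphs"
      unfolding path_graphs_def by auto
    ultimately show ?thesis
      by (intro exI conjI) auto
  qed
qed

text \<open>Straightening each factor by its own map gives the isomorphism, once the coordinates,
  indexed by the type \<open>'n\<close>, are renumbered by the naturals below its
  cardinality.\<close>

lemma interval_product_iso_paths:
  fixes A :: "'n::finite \<Rightarrow> int set"
  assumes ne: "\<And>i. A i \<noteq> {}"
    and conv: "\<And>i a b c. a \<in> A i \<Longrightarrow> b \<in> A i \<Longrightarrow> a \<le> c \<Longrightarrow> c \<le> b \<Longrightarrow> c \<in> A i"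
  shows "\<exists>P. (\<forall>i<CARD('n). P i \<in> path_graphs) \<and>
    graph_iso (induced grid {x. \<forall>i. x $ i \<in> A i}) (cartesian_product {..<CARD('n)} P)"
proof -
  let ?k = "CARD('n)"
  have "\<forall>i. \<exists>B f. int_path B \<in> path_graphs \<and> bij_betw f (A i) B \<and>
      (\<forall>x y. \<bar>f x - f y\<bar> = \<bar>x - y\<bar>)"
    by (intro allI int_interval_iso_path ne) (rule conv)
  then obtain B f where B: "\<And>i. int_path (B i) \<in> path_graphs"
    and f: "\<And>i. bij_betw (f i) (A i) (B i)"
    and f_abs: "\<And>i x y. \<bar>f i x - f i y\<bar> = \<bar>x - y\<bar>"
    by metis
  have f_eq: "f i x = f i y \<longleftrightarrow> x = y" for i x y
    using f_abs[of i x y] by auto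
  obtain h :: "nat \<Rightarrow> 'n" where h: "bij_betw h {..<?k} UNIV"
    using ex_bij_betw_nat_finite[of "UNIV :: 'n set"] by (auto simp: atLeast0LessThan)
  define g where "g = inv_into {..<?k} h"
  have g: "g i < ?k" "h (g i) = i" for i
    using h bij_betw_inv_into_right[OF h, of i] inv_into_into[of i h "{..<?k}"]
    by (auto simp: g_def bij_betw_def)
  have gh: "g (h i) = i" if "i < ?k" for i
    using bij_betw_inv_into_left[OF h] that by (simp add: g_def)
  \<comment> \<open>The restriction makes \<open>F x\<close> equal to \<open>undefined\<close> off
    the index set, as membership in the extensional product demands.\<close>
  define F where "F x = (\<lambda>i\<in>{..<?k}. f (h i) (x $ h i))" for x :: "int ^ 'n"
  define F' where "F' y = (\<chi> i. inv_into (A i) (f i) (y (g i)))" for y :: "nat \<Rightarrow> int"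
  let ?C = "{x. \<forall>i. x $ i \<in> A i}" and ?P = "\<lambda>i. int_path (B (h i))"
  have inv: "inv_into (A i) (f i) z \<in> A i" "f i (inv_into (A i) (f i) z) = z" if "z \<in> B i" for i z
    using f[of i] that by (auto simp: bij_betw_def inv_into_into f_inv_into_f)
  have inv': "inv_into (A i) (f i) (f i z) = z" if "z \<in> A i" for i z
    using f[of i] that by (auto simp: bij_betw_def)
  have fB: "f i z \<in> B i" if "z \<in> A i" for i z
    using f that by (auto simp: bij_betw_def)
  have B_g: "y (g i) \<in> B i" if "y \<in> (\<Pi>\<^sub>E i\<in>{..<?k}. B (h i))" for y i
    using PiE_mem[OF that, of "g i"] g by simp
  have "graph_iso (induced grid ?C) (cartesian_product {..<?k} ?P)"
  proof (rule graph_isoI)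
    have "bij_betw F ?C (\<Pi>\<^sub>E i\<in>{..<?k}. B (h i))"
    proof (rule bij_betw_byWitness[where f' = F'])
      show "\<forall>x\<in>?C. F' (F x) = x"
        by (auto simp: F_def F'_def g inv' vec_eq_iff)
      show "\<forall>y\<in>\<Pi>\<^sub>E i\<in>{..<?k}. B (h i). F (F' y) = y"
      proof
        fix y assume y: "y \<in> (\<Pi>\<^sub>E i\<in>{..<?k}. B (h i))"
        show "F (F' y) = y"
        proof
          fix i
          show "F (F' y) i = y i"
            using y inv(2)[OF PiE_mem[OF y, of i]] PiE_arb[OF y, of i]
            by (cases "i < ?k") (auto simp: F_def F'_def gh)
        qed
      qed
      show "F ` ?C \<subseteq> (\<Pi>\<^sub>E i\<in>{..<?k}. B (h i))"
        using fB by (auto simp: F_def intro!: restrict_PiE_iff[THEN iffD2])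
      show "F' ` (\<Pi>\<^sub>E i\<in>{..<?k}. B (h i)) \<subseteq> ?C"
        using inv(1) B_g by (auto simp: F'_def)
    qed
    then show "bij_betw F (vset (induced grid ?C)) (vset (cartesian_product {..<?k} ?P))"
      by (simp add: induced_def cartesian_product_def)
  next
    fix u v assume "u \<in> vset (induced grid ?C)" "v \<in> vset (induced grid ?C)"
    then have uv: "u \<in> ?C" "v \<in> ?C"
      by (auto simp: induced_def)
    have "adj (cartesian_product {..<?k} ?P) (F u) (F v) \<longleftrightarrow>
        (\<exists>i<?k. \<bar>u $ h i - v $ h i\<bar> = 1 \<and> (\<forall>j\<in>{..<?k} - {i}. u $ h j = v $ h j))"
      using uv by (auto simp: cartesian_product_def F_def fB f_abs f_eq)
    \<comment> \<open>Only the renumbering remains: the coordinate that changes is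
      \<open>h i\<close> in one direction and \<open>g i\<close> in the other.\<close>
    also have "\<dots> \<longleftrightarrow> (\<exists>i. \<bar>u $ i - v $ i\<bar> = 1 \<and> (\<forall>j. j \<noteq> i \<longrightarrow> u $ j = v $ j))"
    proof
      assume "\<exists>i<?k. \<bar>u $ h i - v $ h i\<bar> = 1 \<and> (\<forall>j\<in>{..<?k} - {i}. u $ h j = v $ h j)"
      then obtain i where i: "i < ?k" "\<bar>u $ h i - v $ h i\<bar> = 1"
        "\<And>j. j < ?k \<Longrightarrow> j \<noteq> i \<Longrightarrow> u $ h j = v $ h j" by auto
      have "u $ j = v $ j" if "j \<noteq> h i" for j
        using i(3)[of "g j"] g[of j] that by metis
      with i(2) show "\<exists>i. \<bar>u $ i - v $ i\<bar> = 1 \<and> (\<forall>j. j \<noteq> i \<longrightarrow> u $ j = v $ j)" by blast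
    next
      assume "\<exists>i. \<bar>u $ i - v $ i\<bar> = 1 \<and> (\<forall>j. j \<noteq> i \<longrightarrow> u $ j = v $ j)"
      then obtain i where i: "\<bar>u $ i - v $ i\<bar> = 1" "\<And>j. j \<noteq> i \<Longrightarrow> u $ j = v $ j" by auto
      have "u $ h j = v $ h j" if "j < ?k" "j \<noteq> g i" for j
        using i(2)[of "h j"] gh[of j] that by metis
      with i(1) show "\<exists>i<?k. \<bar>u $ h i - v $ h i\<bar> = 1 \<and> (\<forall>j\<in>{..<?k} - {i}. u $ h j = v $ h j)"
        using g[of i] by (intro exI[of _ "g i"]) auto
    qed
    also have "\<dots> \<longleftrightarrow> adj (induced grid ?C) u v"
      using uv by (simp add: induced_def adj_grid_iff)
    finally show "adj (induced grid ?C) u v \<longleftrightarrow> adj (cartesian_product {..<?k} ?P) (F u) (F v)"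
      by blast
  qed
  then show ?thesis
    using B by (intro exI[of _ ?P]) simp
qed

section \<open>Components of a perfect distance-dominating set as products of intervals\<close>

theorem theorem1:
  fixes S :: "(int ^ 'n) set" and t :: nat
  assumes "t \<ge> 1"
    and "is_PDDS grid t S"
  shows "\<forall>C \<in> graph_components (induced grid S).
           \<exists>(k::nat) (P :: nat \<Rightarrow> int sgraph).
             k \<ge> 1 \<and> (\<forall>i<k. P i \<in> path_graphs) \<and>
             graph_iso (induced (induced grid S) C) (cartesian_product {..<k} P)"
proof
  fix C assume C: "C \<in> graph_components (induced grid S)"
  have CS: "C \<subseteq> S"
    using graph_component_subset[OF C] by (auto simp: induced_def)
  have ne: "C \<noteq> {}"
  proof -
    obtain r where "r \<in> vset (induced grid S)" "C = {v. \<exists>xs. walk_betw (induced grid S) r xs v}"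
      using C by (auto simp: graph_components_def)
    then have "r \<in> C"
      using rtranclp_imp_walk_betw[of "induced grid S" r r] by blast
    then show ?thesis by blast
  qed
  have loc: "locally_convex C"
    unfolding locally_convex_def
    by (metis PDDS_component_common_neighbour[OF assms(2,1) C] vset_grid UNIV_I)
  have "symp (adj (induced grid S))"
    using symp_adj_grid by (auto simp: induced_def symp_def)
  have conv: "grid_box u w \<subseteq> C" if uw: "u \<in> C" "w \<in> C" for u w
  proof (rule locally_convex_imp_convex[OF loc _ uw(1)])
    show "(\<lambda>x y. x \<in> C \<and> y \<in> C \<and> adj grid x y)\<^sup>*\<^sup>* u w"
      by (rule rtranclp_mono[THEN predicate2D,
            OF _ graph_component_connected[OF C \<open>symp (adj (induced grid S))\<close> uw]])
        (auto simp: induced_def)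
  qed
  define A where "A i = (\<lambda>u. u $ i) ` C" for i
  have C_eq: "C = {x. \<forall>i. x $ i \<in> A i}"
    unfolding A_def by (rule convex_imp_product[OF conv ne])
  have A_ne: "A i \<noteq> {}" for i
    using ne by (simp add: A_def)
  have A_conv: "c \<in> A i" if abc: "a \<in> A i" "b \<in> A i" "a \<le> c" "c \<le> b" for i a b c
  proof -
    obtain u w where uw: "u \<in> C" "w \<in> C" "u $ i = a" "w $ i = b"
      using abc by (auto simp: A_def)
    \<comment> \<open>Only coordinate \<open>i\<close> of \<open>u\<close> is changed, to a value
      between those of \<open>u\<close> and \<open>w\<close>, so the vertex stays in their
      box.\<close>
    let ?v = "\<chi> j. if j = i then c else u $ j"
    have "?v \<in> grid_box u w"
      using uw abc by (auto simp: grid_box_def)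
    then have "?v \<in> C"
      using conv uw by blast
    then have "?v $ i \<in> A i"
      unfolding A_def by blast
    then show ?thesis by simp
  qed
  \<comment> \<open>Every coordinate direction contributes a factor; a direction in which
    \<open>C\<close> is constant contributes the path with one vertex.\<close>
  have "\<exists>P. (\<forall>i<CARD('n). P i \<in> path_graphs) \<and>
      graph_iso (induced grid C) (cartesian_product {..<CARD('n)} P)"
    by (subst C_eq, rule interval_product_iso_paths) (fact A_ne, fact A_conv)
  moreover have "induced (induced grid S) C = induced grid C"
    using CS by (auto simp: induced_def fun_eq_iff)
  moreover have "CARD('n) \<ge> 1"
    by (simp add: Suc_le_eq)
  ultimately show "\<exists>(k::nat) (P :: nat \<Rightarrow> int sgraph).
      k \<ge> 1 \<and> (\<forall>i<k. P i \<in> path_graphs) \<and>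
      graph_iso (induced (induced grid S) C) (cartesian_product {..<k} P)"
    by (intro exI[of _ "CARD('n)"]) simp
qed

end
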